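(* Let $f:2^E\to\mathbb{R}_{\ge0}$ be monotone submodular with $f(\varnothing)=0$, and let $x\in\mathbb{R}^E_{\ge0}$. For every $e\in E$, $$w^{(x)}_e:=\max_{S\ni e}\ \min_{T\subseteq E,\ f_T(\{e\})\ne 0}\frac{x(S\setminus T)}{f_T(S)}=\min_{T\subseteq E,\ f_T(\{e\})\ne0}\ \max_{S\ni e}\frac{x(S\setminus T)}{f_T(S)}.$$ Moreover, the output vector $w^{\mathrm{alg}}$ of the procedure described below equals $w^{(x)}$.
   Context: Notation: $x(S):=\sum_{e\in S}x_e$; $f_T(S):=f(S\cup T)-f(T)$ (contraction). The vector $w^{(x)}$ defined by the max–min expression is called the water level vector of $x$ with respect to $f$. Procedure (combinatorial presentation of water levels), input $x\in\mathbb{R}^E_{\ge0}$: set $\ell=0$, $S_0=\varnothing$. While $S_\ell\ne E$: let $S_{\ell+1}$ be the unique inclusion-maximal set among the maximizers of $\frac{x(S\setminus S_\ell)}{f_{S_\ell}(S)}$ over all $S\subseteq E$ with $S\setminus S_\ell\neq\varnothing$; let $t_{\ell+1}=\frac{x(S_{\ell+1}\setminus S_\ell)}{f_{S_\ell}(S_{\ell+1})}$; set $w^{\mathrm{alg}}_e=t_{\ell+1}$ for all $e\in S_{\ell+1}\setminus S_\ell$; increase $\ell$ by one. Return $w^{\mathrm{alg}}$. *)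

theory Defs
  imports "HOL-Library.Extended_Real"
begin

definition submodular_on :: "'a set \<Rightarrow> ('a set \<Rightarrow> real) \<Rightarrow> bool" where
  "submodular_on E f \<longleftrightarrow> (\<forall>A\<subseteq>E. \<forall>B\<subseteq>E. f (A \<union> B) + f (A \<inter> B) \<le> f A + f B)"

definition contract :: "('a set \<Rightarrow> real) \<Rightarrow> 'a set \<Rightarrow> 'a set \<Rightarrow> real" where
  "contract f T S = f (S \<union> T) - f T"

text \<open>
  The ratio of x(S - T) to the contracted value of S. A zero denominator gives infinity, also when
  the numerator is zero (division on \<^typ>\<open>ereal\<close> would give 0 for 0/0). With this convention the
  procedure assigns level infinity to every e with f {e} = 0, which is also the value of the max-min
  expression there: its inner minimum is then over no sets at all.
\<close>

definition density :: "('a set \<Rightarrow> real) \<Rightarrow> ('a \<Rightarrow> real) \<Rightarrow> 'a set \<Rightarrow> 'a set \<Rightarrow> ereal" where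
  "density f x T S =
     (if contract f T S = 0 then \<infinity> else ereal (sum x (S - T) / contract f T S))"

text \<open>
  Minima over T are written as infima in \<^typ>\<open>ereal\<close>. For finite E they are attained, except
  that the infimum over no sets is infinity.
\<close>

definition water_level :: "'a set \<Rightarrow> ('a set \<Rightarrow> real) \<Rightarrow> ('a \<Rightarrow> real) \<Rightarrow> 'a \<Rightarrow> ereal" where
  "water_level E f x e =
     (MAX S\<in>{S. S \<subseteq> E \<and> e \<in> S}. INF T\<in>{T. T \<subseteq> E \<and> contract f T {e} \<noteq> 0}. density f x T S)"

definition densest_sets ::
    "'a set \<Rightarrow> ('a set \<Rightarrow> real) \<Rightarrow> ('a \<Rightarrow> real) \<Rightarrow> 'a set \<Rightarrow> 'a set set" where
  "densest_sets E f x A = {S. is_arg_max (density f x A) (\<lambda>S. S \<subseteq> E \<and> S - A \<noteq> {}) S}"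

definition maximal_densest_sets ::
    "'a set \<Rightarrow> ('a set \<Rightarrow> real) \<Rightarrow> ('a \<Rightarrow> real) \<Rightarrow> 'a set \<Rightarrow> 'a set set" where
  "maximal_densest_sets E f x A =
     {S \<in> densest_sets E f x A. \<not> (\<exists>S'\<in>densest_sets E f x A. S \<subset> S')}"

text \<open>
  \<open>water_run E f x A w\<close>: the loop reaches the state with current set A and levels w assigned so
  far (0 where nothing has been assigned). A step is possible only if the inclusion-maximal
  maximizer is unique, so runs are deterministic, and a run that reaches \<open>A = E\<close> witnesses both
  that every step was well defined and that the loop terminates.
\<close>

inductive water_run ::
    "'a set \<Rightarrow> ('a set \<Rightarrow> real) \<Rightarrow> ('a \<Rightarrow> real) \<Rightarrow> 'a set \<Rightarrow> ('a \<Rightarrow> ereal) \<Rightarrow> bool"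
  for E f x where
  start: "water_run E f x {} (\<lambda>_. 0)"
| step: "water_run E f x A w \<Longrightarrow> A \<noteq> E \<Longrightarrow> maximal_densest_sets E f x A = {S} \<Longrightarrow>
     water_run E f x S (\<lambda>e. if e \<in> S - A then density f x A S else w e)"

definition water_output ::
    "'a set \<Rightarrow> ('a set \<Rightarrow> real) \<Rightarrow> ('a \<Rightarrow> real) \<Rightarrow> ('a \<Rightarrow> ereal) \<Rightarrow> bool" where
  "water_output E f x w \<longleftrightarrow> water_run E f x E w"

end

theory Submission imports Defs begin

text \<open>
  Each step of the procedure strictly lowers the level: if some set had density at least
  \<open>t\<^sub>l\<^sub>+\<^sub>1\<close> over \<open>S\<^sub>l\<^sub>+\<^sub>1\<close>, its union with \<open>S\<^sub>l\<^sub>+\<^sub>1\<close> would be a larger densest set over \<open>S\<^sub>l\<close>.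
  For \<open>e\<close> in \<open>S\<^sub>l\<^sub>+\<^sub>1 - S\<^sub>l\<close> the choice \<open>T = S\<^sub>l\<close> bounds the min-max by \<open>t\<^sub>l\<^sub>+\<^sub>1\<close>. The choice
  \<open>S = S\<^sub>l\<^sub>+\<^sub>1\<close> bounds the max-min from below: telescoping along the chain,
  \<open>x(S\<^sub>l\<^sub>+\<^sub>1 - T)\<close> is the sum of \<open>x(S\<^sub>i\<^sub>+\<^sub>1 - S\<^sub>i - T)\<close>, and optimality of \<open>S\<^sub>i\<^sub>+\<^sub>1\<close> against
  \<open>S\<^sub>i\<^sub>+\<^sub>1 \<inter> T\<close> together with submodularity makes each summand at least
  \<open>t\<^sub>i\<^sub>+\<^sub>1\<close> times the contracted value of \<open>S\<^sub>i\<^sub>+\<^sub>1\<close> over \<open>S\<^sub>i \<union> T\<close>.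
\<close>

definition dual_water_level ::
    "'a set \<Rightarrow> ('a set \<Rightarrow> real) \<Rightarrow> ('a \<Rightarrow> real) \<Rightarrow> 'a \<Rightarrow> ereal" where
  "dual_water_level E f x e =
     (INF T\<in>{T. T \<subseteq> E \<and> contract f T {e} \<noteq> 0}. MAX S\<in>{S. S \<subseteq> E \<and> e \<in> S}. density f x T S)"

locale water_filling =
  fixes E :: "'a set" and f :: "'a set \<Rightarrow> real" and x :: "'a \<Rightarrow> real"
  assumes finite_E: "finite E"
    and mono: "mono_on (Pow E) f"
    and submodular: "submodular_on E f"
    and x_nonneg: "\<And>e. e \<in> E \<Longrightarrow> 0 \<le> x e"
begin

section \<open>Contractions of a monotone submodular function\<close>

lemma finite_subset_E: "S \<subseteq> E \<Longrightarrow> finite S"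
  using finite_E by (rule rev_finite_subset)

lemma f_mono: "A \<subseteq> B \<Longrightarrow> B \<subseteq> E \<Longrightarrow> f A \<le> f B"
  using mono by (auto simp: mono_on_def)

lemma f_submodular: "A \<subseteq> E \<Longrightarrow> B \<subseteq> E \<Longrightarrow> f (A \<union> B) + f (A \<inter> B) \<le> f A + f B"
  using submodular by (auto simp: submodular_on_def)

lemma contract_nonneg: "T \<subseteq> E \<Longrightarrow> S \<subseteq> E \<Longrightarrow> 0 \<le> contract f T S"
  unfolding contract_def using f_mono[of T "S \<union> T"] by auto

lemma contract_mono: "T \<subseteq> E \<Longrightarrow> S \<subseteq> S' \<Longrightarrow> S' \<subseteq> E \<Longrightarrow> contract f T S \<le> contract f T S'"
  unfolding contract_def using f_mono[of "S \<union> T" "S' \<union> T"] by auto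

text \<open>Diminishing returns: submodularity is applied to \<open>S \<union> A\<close> and
  \<open>B\<close>, whose intersection contains \<open>A\<close>.\<close>

lemma contract_antimono:
  assumes "A \<subseteq> B" "B \<subseteq> E" "S \<subseteq> E"
  shows "contract f B S \<le> contract f A S"
proof -
  have "(S \<union> A) \<union> B = S \<union> B" using assms by auto
  moreover have "f A \<le> f ((S \<union> A) \<inter> B)" using assms by (intro f_mono) auto
  moreover have "f ((S \<union> A) \<union> B) + f ((S \<union> A) \<inter> B) \<le> f (S \<union> A) + f B"
    using assms by (intro f_submodular) auto
  ultimately show ?thesis unfolding contract_def by auto
qed

lemma contract_Un_Int:
  assumes "A \<subseteq> E" "S \<subseteq> E" "S' \<subseteq> E"
  shows "contract f A (S \<union> S') + contract f A (S \<inter> S') \<le> contract f A S + contract f A S'"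
proof -
  have "(S \<union> A) \<union> (S' \<union> A) = S \<union> S' \<union> A" "(S \<union> A) \<inter> (S' \<union> A) = S \<inter> S' \<union> A" by auto
  then show ?thesis
    unfolding contract_def using f_submodular[of "S \<union> A" "S' \<union> A"] assms by auto
qed

section \<open>Densities and densest sets\<close>

lemma sum_x_nonneg: "S \<subseteq> E \<Longrightarrow> 0 \<le> sum x S"
  by (rule sum_nonneg) (use x_nonneg in auto)

text \<open>Clearing the denominator survives a zero denominator: the density is then infinite, and
  the right side is nonnegativity of \<open>x\<close>.\<close>

lemma le_density_iff:
  assumes "A \<subseteq> E" "S \<subseteq> E"
  shows "ereal t \<le> density f x A S \<longleftrightarrow> t * contract f A S \<le> sum x (S - A)"
proof (cases "contract f A S = 0")
  case True
  then show ?thesis using sum_x_nonneg[of "S - A"] assms by (auto simp: density_def)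
next
  case False
  then have "contract f A S > 0" using contract_nonneg[OF assms] by auto
  then show ?thesis by (simp add: density_def pos_le_divide_eq)
qed

lemma density_nonneg: "A \<subseteq> E \<Longrightarrow> S \<subseteq> E \<Longrightarrow> 0 \<le> density f x A S"
  using le_density_iff[of A S 0] sum_x_nonneg[of "S - A"] by (auto simp: zero_ereal_def)

lemma density_infinity_iff: "density f x A S = \<infinity> \<longleftrightarrow> contract f A S = 0"
  by (simp add: density_def)

lemma densest_subset: "S \<in> densest_sets E f x A \<Longrightarrow> S \<subseteq> E"
  and densest_diff_nonempty: "S \<in> densest_sets E f x A \<Longrightarrow> S - A \<noteq> {}"
  by (auto simp: densest_sets_def is_arg_max_def)

lemma density_le_densest:
  "S \<in> densest_sets E f x A \<Longrightarrow> U \<subseteq> E \<Longrightarrow> U - A \<noteq> {} \<Longrightarrow> density f x A U \<le> density f x A S"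
  by (auto simp: densest_sets_def is_arg_max_def not_less)

lemma densestI:
  assumes "S \<in> densest_sets E f x A" "U \<subseteq> E" "U - A \<noteq> {}" "density f x A S \<le> density f x A U"
  shows "U \<in> densest_sets E f x A"
  using assms by (auto simp: densest_sets_def is_arg_max_def not_less dest: order_trans)

context
  fixes A S t
  assumes A: "A \<subseteq> E" and S: "S \<in> densest_sets E f x A" and t: "density f x A S = ereal t"
begin

lemma densest_level_nonneg: "0 \<le> t"
  using density_nonneg[OF A densest_subset[OF S]] t by simp

lemma densest_sum_eq: "sum x (S - A) = t * contract f A S"
  using t by (auto simp: density_def split: if_splits)

text \<open>A finite maximum forces every competitor to have a positive denominator, which can be
  cleared. For \<open>U \<subseteq> A\<close>, not a competitor, both sides vanish.\<close>

lemma densest_sum_le: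
  assumes "U \<subseteq> E"
  shows "sum x (U - A) \<le> t * contract f A U"
proof (cases "U - A = {}")
  case True
  then have "U \<union> A = A" by auto
  with True show ?thesis by (simp only: contract_def) simp
next
  case False
  have le: "density f x A U \<le> ereal t" using density_le_densest[OF S assms False] t by simp
  then have "contract f A U \<noteq> 0" by (auto simp: density_def)
  moreover from this have "contract f A U > 0" using contract_nonneg[OF A assms] by auto
  ultimately show ?thesis using le by (simp add: density_def pos_divide_le_eq)
qed

end

text \<open>Uncrossing. At a finite level \<open>t\<close> the function
  \<open>t * contract f A U - sum x (U - A)\<close> of \<open>U\<close> is nonnegative, submodular,
  and zero at \<open>S\<close> and \<open>S'\<close>, hence zero at their union. At level infinity
  \<open>contract f A\<close> itself is such a function.\<close>

lemma densest_Un: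
  assumes A: "A \<subseteq> E" and S: "S \<in> densest_sets E f x A" and S': "S' \<in> densest_sets E f x A"
  shows "S \<union> S' \<in> densest_sets E f x A"
proof -
  note sub = densest_subset[OF S] densest_subset[OF S']
  have eq: "density f x A S' = density f x A S"
    using density_le_densest[OF S sub(2) densest_diff_nonempty[OF S']]
      density_le_densest[OF S' sub(1) densest_diff_nonempty[OF S]] by (rule order_antisym)
  have ge: "density f x A S \<le> density f x A (S \<union> S')"
  proof (cases "density f x A S")
    case (real t)
    with eq have S't: "density f x A S' = ereal t" by simp
    have fin: "finite (S - A)" "finite (S' - A)" using sub finite_subset_E by auto
    have "(S - A) \<union> (S' - A) = S \<union> S' - A" "(S - A) \<inter> (S' - A) = S \<inter> S' - A" by auto
    then have "sum x (S \<union> S' - A) + sum x (S \<inter> S' - A) = sum x (S - A) + sum x (S' - A)"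
      using sum.union_inter[OF fin, of x] by simp
    also have "\<dots> = t * (contract f A S + contract f A S')"
      using densest_sum_eq[OF A S real] densest_sum_eq[OF A S' S't] by (simp add: distrib_left)
    also have "\<dots> \<ge> t * (contract f A (S \<union> S') + contract f A (S \<inter> S'))"
      using contract_Un_Int[OF A sub] densest_level_nonneg[OF A S real] by (intro mult_left_mono)
    finally have "t * contract f A (S \<union> S') \<le> sum x (S \<union> S' - A)"
      using densest_sum_le[OF A S real, of "S \<inter> S'"] sub by (simp add: distrib_left le_infI1)
    then show ?thesis using le_density_iff[OF A, of "S \<union> S'" t] sub real by simp
  next
    case PInf
    with eq have "contract f A S = 0" "contract f A S' = 0"
      by (simp_all flip: density_infinity_iff)
    moreover have "0 \<le> contract f A (S \<inter> S')" "0 \<le> contract f A (S \<union> S')"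
      using A sub by (auto intro!: contract_nonneg)
    ultimately have "contract f A (S \<union> S') = 0" using contract_Un_Int[OF A sub] by linarith
    then show ?thesis by (simp add: density_def)
  next
    case MInf
    then show ?thesis by simp
  qed
  show ?thesis using densestI[OF S _ _ ge] sub densest_diff_nonempty[OF S] by blast
qed

lemma densest_sets_nonempty:
  assumes "A \<subset> E"
  shows "densest_sets E f x A \<noteq> {}"
proof -
  let ?C = "{S. S \<subseteq> E \<and> S - A \<noteq> {}}"
  have "finite ?C" "?C \<noteq> {}" using finite_E assms by auto
  then have fin: "finite (density f x A ` ?C)" and "density f x A ` ?C \<noteq> {}" by auto
  from Max_in[OF this] obtain S where "S \<in> ?C" "Max (density f x A ` ?C) = density f x A S" by blast
  then have "S \<in> densest_sets E f x A"
    using Max_ge[OF fin] by (auto simp: densest_sets_def is_arg_max_def not_less)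
  then show ?thesis by blast
qed

text \<open>Closure under unions makes an inclusion-maximal densest set absorb all others, so the
  loop can always step.\<close>

lemma maximal_densest_unique:
  assumes "A \<subset> E"
  obtains S where "maximal_densest_sets E f x A = {S}"
proof -
  let ?D = "densest_sets E f x A"
  have "finite ?D" by (rule finite_subset[of _ "Pow E"]) (auto dest: densest_subset simp: finite_E)
  then obtain S where S: "S \<in> ?D" "\<And>S'. S' \<in> ?D \<Longrightarrow> S \<subseteq> S' \<Longrightarrow> S = S'"
    using finite_has_maximal[OF _ densest_sets_nonempty[OF assms]] by metis
  have "S' \<subseteq> S" if "S' \<in> ?D" for S'
    using S(2)[OF densest_Un[OF _ S(1) that]] assms by auto
  with S(1) have "maximal_densest_sets E f x A = {S}"
    unfolding maximal_densest_sets_def by blast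
  then show thesis by (rule that)
qed

section \<open>The inclusion-maximal densest set\<close>

context
  fixes A S
  assumes A: "A \<subseteq> E" and max: "S \<in> maximal_densest_sets E f x A"
begin

lemma maximal_densest: "S \<in> densest_sets E f x A"
  using max by (simp add: maximal_densest_sets_def)

text \<open>Adding \<open>A\<close> to \<open>S\<close> changes neither numerator nor denominator,
  so maximality forces \<open>A\<close> into \<open>S\<close>.\<close>

lemma maximal_densest_superset: "A \<subset> S"
proof -
  note D = maximal_densest
  have "density f x A (S \<union> A) = density f x A S"
    by (simp add: density_def contract_def Un_Diff Un_assoc)
  then have "S \<union> A \<in> densest_sets E f x A"
    using densest_subset[OF D] densest_diff_nonempty[OF D] A by (intro densestI[OF D]) auto
  then have "\<not> S \<subset> S \<union> A" using max by (simp add: maximal_densest_sets_def)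
  then have "S \<union> A = S" by blast
  then show ?thesis using densest_diff_nonempty[OF D] by auto
qed

lemma density_over_maximal_densest_less:
  assumes U: "U \<subseteq> E" "U - S \<noteq> {}"
  shows "density f x S U < density f x A S"
proof (rule ccontr)
  assume "\<not> ?thesis"
  then have ge: "density f x A S \<le> density f x S U" by simp
  note D = maximal_densest and AS = maximal_densest_superset
  note SE = densest_subset[OF D]
  have split: "contract f A (S \<union> U) = contract f A S + contract f S U"
  proof -
    have "S \<union> U \<union> A = U \<union> S" "S \<union> A = S" using AS by auto
    then show ?thesis by (simp add: contract_def)
  qed
  \<comment> \<open>Numerator and denominator of \<open>S \<union> U\<close> over \<open>A\<close>
    are the sums of those of \<open>S\<close> over \<open>A\<close> and \<open>U\<close> over
    \<open>S\<close>, so common lower bounds of these two densities carry over.\<close>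
  have "density f x A S \<le> density f x A (S \<union> U)"
  proof (cases "density f x A S")
    case (real t)
    have "sum x (S \<union> U - A) = sum x (S - A) + sum x (U - S)"
    proof -
      have "S \<union> U - A = (S - A) \<union> (U - S)" using AS by auto
      then show ?thesis
        by (simp, intro sum.union_disjoint) (use SE U finite_subset_E in auto)
    qed
    moreover have "t * contract f S U \<le> sum x (U - S)"
      using ge le_density_iff[OF SE U(1)] real by simp
    ultimately show ?thesis
      using le_density_iff[OF A, of "S \<union> U" t] densest_sum_eq[OF A D real] split SE U real
      by (simp add: distrib_left)
  next
    case PInf
    then have "contract f A S = 0" "contract f S U = 0"
      using ge by (simp_all flip: density_infinity_iff)
    then show ?thesis using split by (simp add: density_def)
  next
    case MInf
    then show ?thesis by simp
  qed
  then have "S \<union> U \<in> densest_sets E f x A"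
    using U SE AS by (intro densestI[OF D]) auto
  then have "\<not> S \<subset> S \<union> U" using max by (simp add: maximal_densest_sets_def)
  then show False using U by auto
qed

text \<open>Allowing every real \<open>t\<close> up to the level covers infinite levels and lets
  steps with different levels be added using one common factor.\<close>

lemma maximal_densest_step_lower_bound:
  assumes t: "ereal t \<le> density f x A S" "T \<subseteq> E"
  shows "t * contract f (A \<union> T) S \<le> sum x (S - (A \<union> T))"
proof (cases "density f x A S")
  case (real \<tau>)
  note D = maximal_densest and AS = maximal_densest_superset
  note SE = densest_subset[OF D]
  have "sum x (S - A) = sum x ((S - (A \<union> T)) \<union> (S \<inter> T - A))"
    by (rule arg_cong[where f = "sum x"]) auto
  also have "\<dots> = sum x (S - (A \<union> T)) + sum x (S \<inter> T - A)"
    by (rule sum.union_disjoint) (use SE finite_subset_E in auto)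
  \<comment> \<open>The value at \<open>S\<close> is exact, while \<open>S \<inter> T\<close> only
    obeys the upper bound; subtracting gives the estimate.\<close>
  finally have "sum x (S - (A \<union> T)) \<ge> \<tau> * contract f A S - \<tau> * contract f A (S \<inter> T)"
    using densest_sum_eq[OF A D real] densest_sum_le[OF A D real, of "S \<inter> T"] SE
    by (simp add: le_infI1)
  moreover have "contract f (A \<union> T) S \<le> contract f A S - contract f A (S \<inter> T)"
  proof -
    have "S \<union> (A \<union> T) = S \<union> T" "S \<inter> (A \<union> T) = S \<inter> T \<union> A" "S \<union> A = S" using AS by auto
    then show ?thesis
      using f_submodular[of S "A \<union> T"] SE A t by (simp add: contract_def)
  qed
  then have "\<tau> * contract f (A \<union> T) S \<le> \<tau> * (contract f A S - contract f A (S \<inter> T))"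
    by (rule mult_left_mono[OF _ densest_level_nonneg[OF A D real]])
  moreover have "t * contract f (A \<union> T) S \<le> \<tau> * contract f (A \<union> T) S"
    using t real SE A by (intro mult_right_mono contract_nonneg) auto
  ultimately show ?thesis by (simp add: right_diff_distrib)
next
  case PInf
  note SE = densest_subset[OF maximal_densest]
  \<comment> \<open>At level infinity the contracted value of \<open>S\<close> is zero over
    \<open>A\<close>, hence over \<open>A \<union> T\<close>.\<close>
  have "contract f (A \<union> T) S \<le> contract f A S" using A SE t by (intro contract_antimono) auto
  with PInf have "contract f (A \<union> T) S = 0"
    using contract_nonneg[of "A \<union> T" S] A SE t by (auto simp: density_infinity_iff)
  then show ?thesis using sum_x_nonneg[of "S - (A \<union> T)"] SE by auto
next
  case MInf
  then show ?thesis using t by simp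
qed

end

section \<open>The max-min and min-max expressions\<close>

lemma finite_supersets: "finite {S. S \<subseteq> E \<and> e \<in> S}"
  using finite_E by simp

lemma supersets_nonempty: "e \<in> E \<Longrightarrow> {S. S \<subseteq> E \<and> e \<in> S} \<noteq> {}"
  by auto

lemma water_level_geI:
  assumes "S \<subseteq> E" "e \<in> S" "\<And>T. T \<subseteq> E \<Longrightarrow> contract f T {e} \<noteq> 0 \<Longrightarrow> c \<le> density f x T S"
  shows "c \<le> water_level E f x e"
proof -
  have "c \<le> (INF T\<in>{T. T \<subseteq> E \<and> contract f T {e} \<noteq> 0}. density f x T S)"
    using assms by (intro INF_greatest) auto
  also have "\<dots> \<le> water_level E f x e"
    unfolding water_level_def using assms finite_supersets by (intro Max_ge) auto
  finally show ?thesis .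
qed

lemma dual_water_level_leI:
  assumes "T \<subseteq> E" "contract f T {e} \<noteq> 0" "e \<in> E"
    and "\<And>S. S \<subseteq> E \<Longrightarrow> e \<in> S \<Longrightarrow> density f x T S \<le> c"
  shows "dual_water_level E f x e \<le> c"
proof -
  have "dual_water_level E f x e \<le> (MAX S\<in>{S. S \<subseteq> E \<and> e \<in> S}. density f x T S)"
    unfolding dual_water_level_def using assms by (intro INF_lower) auto
  also have "\<dots> \<le> c"
    using assms finite_supersets supersets_nonempty by (intro Max.boundedI) auto
  finally show ?thesis .
qed

text \<open>Weak duality: \<open>density f x T S\<close> lies between the inner minimum for
  \<open>S\<close> and the inner maximum for \<open>T\<close>. Since \<open>e \<in> E\<close>, the
  maxima range over nonempty families.\<close>

lemma water_level_le_dual: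
  assumes "e \<in> E"
  shows "water_level E f x e \<le> dual_water_level E f x e"
  unfolding dual_water_level_def
proof (rule INF_greatest)
  fix T assume T: "T \<in> {T. T \<subseteq> E \<and> contract f T {e} \<noteq> 0}"
  show "water_level E f x e \<le> (MAX S\<in>{S. S \<subseteq> E \<and> e \<in> S}. density f x T S)"
    unfolding water_level_def
  proof (rule Max.boundedI)
    fix a
    assume "a \<in> (\<lambda>S. INF T\<in>{T. T \<subseteq> E \<and> contract f T {e} \<noteq> 0}. density f x T S)
                 ` {S. S \<subseteq> E \<and> e \<in> S}"
    then obtain S where S: "S \<subseteq> E" "e \<in> S"
      "a = (INF T\<in>{T. T \<subseteq> E \<and> contract f T {e} \<noteq> 0}. density f x T S)" by auto
    have "a \<le> density f x T S" unfolding S(3) using T by (rule INF_lower)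
    also have "\<dots> \<le> (MAX S\<in>{S. S \<subseteq> E \<and> e \<in> S}. density f x T S)"
      using S finite_supersets by (intro Max_ge) auto
    finally show "a \<le> (MAX S\<in>{S. S \<subseteq> E \<and> e \<in> S}. density f x T S)" .
  qed (use assms finite_supersets supersets_nonempty in auto)
qed

section \<open>The loop invariant and its preservation\<close>

text \<open>
  \<open>l\<close> is the level of the last step, and infinity at the start, where no step has been taken.
\<close>

definition run_invariant :: "'a set \<Rightarrow> ('a \<Rightarrow> ereal) \<Rightarrow> ereal \<Rightarrow> bool" where
  "run_invariant A w l \<longleftrightarrow>
     A \<subseteq> E \<and>
     (\<forall>e\<in>A. w e = water_level E f x e \<and> w e = dual_water_level E f x e) \<and>
     (A = {} \<or> (\<forall>U. U \<subseteq> E \<longrightarrow> U - A \<noteq> {} \<longrightarrow> density f x A U < l)) \<and>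
     (\<forall>t T. ereal t \<le> l \<longrightarrow> T \<subseteq> E \<longrightarrow> t * contract f T A \<le> sum x (A - T))"

text \<open>The third conjunct puts the new level strictly below \<open>l\<close>, so the old lower
  bound applies to every \<open>t\<close> admissible now. The exception \<open>A = {}\<close> is
  there because the first level may itself be infinite.\<close>

lemma run_invariant_step:
  assumes inv: "run_invariant A w l" and max: "S \<in> maximal_densest_sets E f x A"
  shows "run_invariant S (\<lambda>e. if e \<in> S - A then density f x A S else w e) (density f x A S)"
proof -
  let ?\<tau> = "density f x A S"
  have A: "A \<subseteq> E"
    and levels: "\<forall>e\<in>A. w e = water_level E f x e \<and> w e = dual_water_level E f x e"
    and less: "A = {} \<or> (\<forall>U. U \<subseteq> E \<longrightarrow> U - A \<noteq> {} \<longrightarrow> density f x A U < l)"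
    and lower: "\<forall>t T. ereal t \<le> l \<longrightarrow> T \<subseteq> E \<longrightarrow> t * contract f T A \<le> sum x (A - T)"
    using inv unfolding run_invariant_def by iprover+
  note D = maximal_densest[OF A max] and AS = maximal_densest_superset[OF A max]
  note SE = densest_subset[OF D]
  have lower_S: "t * contract f T S \<le> sum x (S - T)" if t: "ereal t \<le> ?\<tau>" and T: "T \<subseteq> E" for t T
  proof -
    have "t * contract f T A \<le> sum x (A - T)"
    proof (cases "A = {}")
      case False
      then have "?\<tau> < l" using less SE densest_diff_nonempty[OF D] by blast
      with t have "ereal t \<le> l" by simp
      with T show ?thesis using lower by blast
    qed (simp add: contract_def)
    moreover have "t * contract f (A \<union> T) S \<le> sum x (S - (A \<union> T))"
      by (rule maximal_densest_step_lower_bound[OF A max t T])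
    \<comment> \<open>Telescoping along \<open>T\<close>, \<open>A \<union> T\<close>,
      \<open>S \<union> T\<close>; the numerator splits in the same way.\<close>
    moreover have "contract f T S = contract f T A + contract f (A \<union> T) S"
    proof -
      have "S \<union> (A \<union> T) = S \<union> T" using AS by auto
      then show ?thesis by (simp add: contract_def)
    qed
    moreover have "sum x (S - T) = sum x (A - T) + sum x (S - (A \<union> T))"
    proof -
      have "S - T = (A - T) \<union> (S - (A \<union> T))" using AS by auto
      then show ?thesis
        by (simp, intro sum.union_disjoint) (use SE A finite_subset_E in auto)
    qed
    ultimately show ?thesis by (simp add: distrib_left)
  qed
  have new: "?\<tau> = water_level E f x e \<and> ?\<tau> = dual_water_level E f x e" if e: "e \<in> S - A" for e
  proof -
    have eE: "e \<in> E" using e SE by auto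
    have "?\<tau> \<le> water_level E f x e"
    proof (rule water_level_geI[OF SE])
      show "e \<in> S" using e by auto
      fix T assume T: "T \<subseteq> E"
      show "?\<tau> \<le> density f x T S" if "contract f T {e} \<noteq> 0"
      proof (cases ?\<tau>)
        case (real t)
        then show ?thesis using lower_S[OF _ T, of t] le_density_iff[OF T SE, of t] by simp
      next
        case PInf
        \<comment> \<open>Only the first step can have an infinite level. Then \<open>e\<close> has
          contracted value zero over every \<open>T\<close>, so no \<open>T\<close> is
          admissible.\<close>
        have "A = {} \<or> ?\<tau> < l" using less SE densest_diff_nonempty[OF D] by blast
        with PInf have "A = {}" by simp
        with PInf have "contract f {} S = 0" by (simp add: density_infinity_iff)
        moreover have "contract f T {e} \<le> contract f {} {e}"
          using T eE by (intro contract_antimono) auto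
        moreover have "contract f {} {e} \<le> contract f {} S"
          using e SE by (intro contract_mono) auto
        ultimately have "contract f T {e} = 0" using contract_nonneg[OF T, of "{e}"] eE by auto
        with that show ?thesis by simp
      next
        case MInf
        then show ?thesis by simp
      qed
    qed
    \<comment> \<open>The witness is \<open>T = A\<close>. If it is inadmissible, \<open>{e}\<close>
      has infinite density over \<open>A\<close>, so the level is infinite and the bound is
      trivial.\<close>
    moreover have "dual_water_level E f x e \<le> ?\<tau>"
    proof (cases "contract f A {e} = 0")
      case True
      then have "density f x A {e} = \<infinity>" by (simp add: density_infinity_iff)
      moreover have "density f x A {e} \<le> ?\<tau>" using e eE by (intro density_le_densest[OF D]) auto
      ultimately show ?thesis by simp
    next
      case False
      then show ?thesis
        using A eE e by (intro dual_water_level_leI[of A]) (auto intro!: density_le_densest[OF D])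
    qed
    ultimately show ?thesis using water_level_le_dual[OF eE] by auto
  qed
  show ?thesis
    unfolding run_invariant_def
  proof (intro conjI)
    show "\<forall>e\<in>S. (if e \<in> S - A then ?\<tau> else w e) = water_level E f x e \<and>
                (if e \<in> S - A then ?\<tau> else w e) = dual_water_level E f x e"
    proof
      fix e assume "e \<in> S"
      then show "(if e \<in> S - A then ?\<tau> else w e) = water_level E f x e \<and>
                 (if e \<in> S - A then ?\<tau> else w e) = dual_water_level E f x e"
        using new[of e] bspec[OF levels, of e] by (metis DiffD2 DiffI)
    qed
    show "S = {} \<or> (\<forall>U. U \<subseteq> E \<longrightarrow> U - S \<noteq> {} \<longrightarrow> density f x S U < ?\<tau>)"
      using density_over_maximal_densest_less[OF A max] by blast
  qed (use SE lower_S in blast)+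
qed

section \<open>Runs of the procedure: correctness and termination\<close>

lemma water_run_invariant: "water_run E f x A w \<Longrightarrow> \<exists>l. run_invariant A w l"
proof (induction rule: water_run.induct)
  case start
  have "run_invariant {} (\<lambda>_. 0) \<infinity>" by (simp add: run_invariant_def contract_def)
  then show ?case ..
next
  case (step A w S)
  then show ?case using run_invariant_step[of A w _ S] by auto
qed

text \<open>Each step strictly enlarges the current set inside the finite \<open>E\<close>. Starting
  from an arbitrary reachable state makes the induction on \<open>card (E - A)\<close>
  possible.\<close>

lemma water_run_completes:
  assumes "water_run E f x A w"
  shows "\<exists>w. water_run E f x E w"
  using assms
proof (induction "card (E - A)" arbitrary: A w rule: less_induct)
  case less
  have A: "A \<subseteq> E" using water_run_invariant[OF less.prems] by (auto simp: run_invariant_def)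
  show ?case
  proof (cases "A = E")
    case True
    then show ?thesis using less.prems by auto
  next
    case False
    then obtain S where S: "maximal_densest_sets E f x A = {S}"
      using A maximal_densest_unique by blast
    then have max: "S \<in> maximal_densest_sets E f x A" by simp
    have "E - S \<subset> E - A"
      using maximal_densest_superset[OF A max] densest_subset[OF maximal_densest[OF A max]] by auto
    then have "card (E - S) < card (E - A)" using finite_E by (intro psubset_card_mono) auto
    then show ?thesis using less.hyps water_run.step[OF less.prems False S] by blast
  qed
qed

lemma water_output_exists: "\<exists>w. water_output E f x w"
  unfolding water_output_def using water_run.start by (rule water_run_completes)

lemma water_output_levels:
  assumes "water_output E f x w" "e \<in> E"
  shows "w e = water_level E f x e" "w e = dual_water_level E f x e"
  using water_run_invariant[of E w] assms by (auto simp: water_output_def run_invariant_def)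

end

theorem theorem3p2:
  fixes E :: "'a set" and f :: "'a set \<Rightarrow> real" and x :: "'a \<Rightarrow> real"
  assumes "finite E"
    and "\<And>S. S \<subseteq> E \<Longrightarrow> 0 \<le> f S"
    and "mono_on (Pow E) f"
    and "submodular_on E f"
    and "f {} = 0"
    and "\<And>e. e \<in> E \<Longrightarrow> 0 \<le> x e"
  shows "(\<forall>e\<in>E. water_level E f x e =
            (INF T\<in>{T. T \<subseteq> E \<and> contract f T {e} \<noteq> 0}. MAX S\<in>{S. S \<subseteq> E \<and> e \<in> S}. density f x T S))
       \<and> (\<exists>w. water_output E f x w)
       \<and> (\<forall>w. water_output E f x w \<longrightarrow> (\<forall>e\<in>E. w e = water_level E f x e))"
proof -
  interpret water_filling E f x by unfold_locales (use assms in auto)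
  \<comment> \<open>Minimax equality is read off from one completed run, whose output equals both
    expressions.\<close>
  obtain w where "water_output E f x w" using water_output_exists by blast
  then have "water_level E f x e = dual_water_level E f x e" if "e \<in> E" for e
    using water_output_levels that by metis
  then show ?thesis
    using water_output_exists water_output_levels(1) unfolding dual_water_level_def by blast
qed

end
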